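(* Let $n\ge 2$. A permutation $\pi$ of $\{1,\dots,n\}$ is a polynomial interchange if and only if it is separable.
   Context: A permutation $\pi$ of $\{1,\dots,n\}$ is a polynomial interchange if there exist $n$ real polynomials $P_1,\dots,P_n$ in one variable such that - $P_1(x)<P_2(x)<\dots<P_n(x)$ for all sufficiently small negative $x$, - $P_{\pi(1)}(x)<P_{\pi(2)}(x)<\dots<P_{\pi(n)}(x)$ for all sufficiently small positive $x$. A permutation $\pi$ of $\{1,\dots,n\}$ is separable if there do not exist four indices $1\le i_1<i_2<i_3<i_4\le n$ such that $\pi(i_2)<\pi(i_4)<\pi(i_1)<\pi(i_3)$ or $\pi(i_3)<\pi(i_1)<\pi(i_4)<\pi(i_2)$. *)

theory Defs
  imports
    Complex_Main
    "HOL-Computational_Algebra.Polynomial"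
    "HOL-Combinatorics.Permutations"
begin

(* "Sufficiently small negative (positive) x" means x close to 0 on that side:
   the filters at_left 0 and at_right 0. *)
definition polynomial_interchange :: "nat \<Rightarrow> (nat \<Rightarrow> nat) \<Rightarrow> bool" where
  "polynomial_interchange n \<pi> \<longleftrightarrow>
     (\<exists>P :: nat \<Rightarrow> real poly.
        (\<forall>\<^sub>F x in at_left 0. \<forall>i\<in>{1..<n}. poly (P i) x < poly (P (i + 1)) x) \<and>
        (\<forall>\<^sub>F x in at_right 0. \<forall>i\<in>{1..<n}. poly (P (\<pi> i)) x < poly (P (\<pi> (i + 1))) x))"

definition separable_perm :: "nat \<Rightarrow> (nat \<Rightarrow> nat) \<Rightarrow> bool" where
  "separable_perm n \<pi> \<longleftrightarrow>
     \<not> (\<exists>i\<^sub>1 i\<^sub>2 i\<^sub>3 i\<^sub>4. 1 \<le> i\<^sub>1 \<and> i\<^sub>1 < i\<^sub>2 \<and> i\<^sub>2 < i\<^sub>3 \<and> i\<^sub>3 < i\<^sub>4 \<and> i\<^sub>4 \<le> n \<and>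
          ((\<pi> i\<^sub>2 < \<pi> i\<^sub>4 \<and> \<pi> i\<^sub>4 < \<pi> i\<^sub>1 \<and> \<pi> i\<^sub>1 < \<pi> i\<^sub>3) \<or>
           (\<pi> i\<^sub>3 < \<pi> i\<^sub>1 \<and> \<pi> i\<^sub>1 < \<pi> i\<^sub>4 \<and> \<pi> i\<^sub>4 < \<pi> i\<^sub>2)))"

end

theory Submission
  imports Defs
begin

text \<open>
  Compare two polynomials of a realising family through the order of vanishing at \<open>0\<close> of their
  difference: the two graphs cross at \<open>0\<close> exactly when this order is odd.  So \<open>\<pi>\<close> prescribes the
  parity of the order of every difference.

  A polynomial interchange is separable because the order behaves like a non-archimedean valuation.
  Let \<open>A < B < C < D\<close> to the right of \<open>0\<close>.  The three gaps \<open>B - A\<close>, \<open>C - B\<close>, \<open>D - C\<close> are positive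
  there, so nothing cancels in a sum of them and the order of a sum is the minimum of the orders
  (\<open>order_add_positive\<close>).  In both forbidden patterns the order of \<open>C - A\<close> has another parity
  than that of \<open>B - A\<close>, so it is the order of \<open>C - B\<close>, which is smaller than that of \<open>B - A\<close>.
  In the same way the order of \<open>C - B\<close> is smaller than that of \<open>D - C\<close>.  Hence \<open>D - A\<close> and
  \<open>C - B\<close> have the same order, but both patterns demand different parities
  (\<open>no_forbidden_parities\<close>).

  Conversely, a pattern-free injection on a finite set of at least two points splits into a left and a right part
  such that either all values on the left are below all values on the right, or all are above
  (\<open>pattern_free_split\<close>).  Given realising families for the two parts, multiply
  both by \<open>x\<^sup>2\<close>, which changes no sign, and add to the right part \<open>1\<close> in the first case and \<open>x\<close> in the
  second.  Near \<open>0\<close> the added term dominates, so that the two parts keep their order or change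
  it at \<open>0\<close>, as required (\<open>pattern_free_imp_realisable\<close>).
\<close>

section \<open>Signs near zero and the order of vanishing\<close>

lemma eventually_poly_pos:
  fixes q :: "real poly"
  assumes "poly q 0 > 0"
  shows "\<forall>\<^sub>F x in at 0 within S. poly q x > 0"
proof -
  have "(poly q \<longlongrightarrow> poly q 0) (at 0 within S)"
    by (intro tendsto_intros)
  then show ?thesis using assms by (rule order_tendstoD(1))
qed

lemma at_right_positive: "\<forall>\<^sub>F x::real in at_right 0. x > 0"
  by (simp add: eventually_at_right_less)

lemma at_left_negative: "\<forall>\<^sub>F x::real in at_left 0. x < 0"
  by (simp add: eventually_at_filter)

lemma positive_decomp:
  fixes p :: "real poly"
  assumes "\<forall>\<^sub>F x in at_right 0. poly p x > 0"
  obtains q where "p = monom 1 (order 0 p) * q" and "poly q 0 > 0"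
proof -
  have "p \<noteq> 0"
  proof
    assume "p = 0"
    with assms have "\<forall>\<^sub>F x::real in at_right 0. False" by simp
    then show False by simp
  qed
  from order_decomp[OF this, of 0] obtain q where
    q: "p = [:- 0, 1:] ^ order 0 p * q" "\<not> [:- 0, 1:] dvd q" by blast
  have pq: "p = monom 1 (order 0 p) * q"
    using q(1) by (simp add: monom_altdef)
  have "poly q 0 \<noteq> 0" using q(2) by (simp only: poly_eq_0_iff_dvd not_False_eq_True)
  moreover have False if neg: "poly q 0 < 0"
  proof -
    have "\<forall>\<^sub>F x in at_right 0. poly (- q) x > 0"
      using neg by (intro eventually_poly_pos) simp
    with assms at_right_positive have "\<forall>\<^sub>F x::real in at_right 0. False"
    proof eventually_elim
      case (elim x)
      have "poly p x = x ^ order 0 p * poly q x"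
        by (subst pq) (simp add: poly_monom)
      with elim show False by (simp add: zero_less_mult_iff)
    qed
    then show False by simp
  qed
  ultimately have "poly q 0 > 0" by fastforce
  with pq that show ?thesis by blast
qed

lemma order_monom_mult:
  fixes q :: "real poly"
  assumes "poly q 0 \<noteq> 0"
  shows "order 0 (monom 1 k * q) = k"
proof -
  have "order 0 (monom 1 k * q) = order 0 (monom 1 k :: real poly) + order 0 q"
    using assms by (intro order_mult) auto
  also have "order 0 q = 0" using assms by (rule order_0I)
  also have "order 0 (monom 1 k :: real poly) = k"
    using order_power_n_n[of "0::real" k] by (simp add: monom_altdef)
  finally show ?thesis by simp
qed

text \<open>Both leading coefficients at \<open>0\<close> are positive, so they cannot cancel.\<close>

lemma order_add_positive:
  fixes p q :: "real poly"
  assumes "\<forall>\<^sub>F x in at_right 0. poly p x > 0" "\<forall>\<^sub>F x in at_right 0. poly q x > 0"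
  shows "order 0 (p + q) = min (order 0 p) (order 0 q)"
proof -
  have *: "order 0 (p + q) = order 0 p" if le: "order 0 p \<le> order 0 q"
    and pos: "\<forall>\<^sub>F x in at_right 0. poly p x > 0" "\<forall>\<^sub>F x in at_right 0. poly q x > 0"
    for p q :: "real poly"
  proof -
    from positive_decomp[OF pos(1)] obtain p' where
      p: "p = monom 1 (order 0 p) * p'" "poly p' 0 > 0" .
    from positive_decomp[OF pos(2)] obtain q' where
      q: "q = monom 1 (order 0 q) * q'" "poly q' 0 > 0" .
    define r where "r = p' + monom 1 (order 0 q - order 0 p) * q'"
    have "monom 1 (order 0 q) = (monom 1 (order 0 p) * monom 1 (order 0 q - order 0 p) :: real poly)"
      using le by (simp add: mult_monom)
    with p(1) q(1) have "p + q = monom 1 (order 0 p) * r"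
      unfolding r_def by (metis distrib_left mult.assoc)
    moreover have "poly r 0 > 0"
      using p(2) q(2) by (simp add: r_def poly_monom add_pos_nonneg)
    ultimately show ?thesis by (simp add: order_monom_mult)
  qed
  show ?thesis
    using *[of p q] *[of q p] assms by (cases "order 0 p \<le> order 0 q") (auto simp: add.commute)
qed

lemma sign_at_left_by_order_parity:
  fixes p :: "real poly"
  assumes "\<forall>\<^sub>F x in at_right 0. poly p x > 0"
  shows "even (order 0 p) \<Longrightarrow> \<forall>\<^sub>F x in at_left 0. poly p x > 0"
    and "odd (order 0 p) \<Longrightarrow> \<forall>\<^sub>F x in at_left 0. poly p x < 0"
proof -
  from positive_decomp[OF assms] obtain q where
    q: "p = monom 1 (order 0 p) * q" "poly q 0 > 0" .
  have val: "poly p x = x ^ order 0 p * poly q x" for x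
    by (subst q(1)) (simp add: poly_monom)
  have ev: "\<forall>\<^sub>F x in at_left 0. poly q x > 0"
    using q(2) by (rule eventually_poly_pos)
  show "\<forall>\<^sub>F x in at_left 0. poly p x > 0" if "even (order 0 p)"
    using ev at_left_negative
    by eventually_elim (use that in \<open>simp add: val zero_less_power_eq\<close>)
  show "\<forall>\<^sub>F x in at_left 0. poly p x < 0" if "odd (order 0 p)"
    using ev at_left_negative
    by eventually_elim (use that in \<open>simp add: val mult_less_0_iff power_less_zero_eq\<close>)
qed

lemma no_forbidden_parities:
  fixes p q r :: "real poly"
  assumes "\<forall>\<^sub>F x in at_right 0. poly p x > 0"
    and "\<forall>\<^sub>F x in at_right 0. poly q x > 0"
    and "\<forall>\<^sub>F x in at_right 0. poly r x > 0"
    and pq: "even (order 0 p) \<noteq> even (order 0 (p + q))"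
    and qr: "even (order 0 r) \<noteq> even (order 0 (q + r))"
  shows "even (order 0 (p + q + r)) = even (order 0 q)"
proof -
  have "\<forall>\<^sub>F x in at_right 0. poly (p + q) x > 0"
    using assms(1,2) by eventually_elim simp
  then have "order 0 (p + q + r) = min (min (order 0 p) (order 0 q)) (order 0 r)"
    using assms(1-3) by (simp add: order_add_positive)
  moreover have "order 0 q < order 0 p" "order 0 q < order 0 r"
    using pq qr order_add_positive[OF assms(1,2)] order_add_positive[OF assms(2,3)]
    by (metis min.absorb1 min.absorb2 not_less nle_le)+
  ultimately show ?thesis by simp
qed

section \<open>Realising families\<close>

text \<open>
  Indexing the family by positions and prescribing all pairwise comparisons, instead of those of
  neighbours only, makes the notion meaningful on an arbitrary set \<open>S\<close> of positions and stable under
  restriction: no renumbering is needed when a permutation is cut into pieces.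
\<close>

definition realises :: "'a::linorder set \<Rightarrow> ('a \<Rightarrow> 'b::linorder) \<Rightarrow> ('a \<Rightarrow> real poly) \<Rightarrow> bool" where
  "realises S \<pi> Q \<longleftrightarrow>
     (\<forall>i\<in>S. \<forall>j\<in>S. i < j \<longrightarrow> (\<forall>\<^sub>F x in at_right 0. poly (Q i) x < poly (Q j) x)) \<and>
     (\<forall>i\<in>S. \<forall>j\<in>S. \<pi> i < \<pi> j \<longrightarrow> (\<forall>\<^sub>F x in at_left 0. poly (Q i) x < poly (Q j) x))"

lemma chain_less:
  fixes f :: "nat \<Rightarrow> real"
  assumes step: "\<And>k. k \<in> {1..<n} \<Longrightarrow> f k < f (k + 1)" and "i < j" "1 \<le> i" "j \<le> n"
  shows "f i < f j"
  using assms(2,4)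
proof (induction j)
  case (Suc j)
  have "f j < f (Suc j)" using step[of j] Suc.prems \<open>1 \<le> i\<close> by simp
  with Suc show ?case by (cases "i = j") auto
qed simp

lemma polynomial_interchange_iff_realisable:
  assumes "\<pi> permutes {1..n}"
  shows "polynomial_interchange n \<pi> \<longleftrightarrow> (\<exists>Q. realises {1..n} \<pi> Q)"
proof
  assume "polynomial_interchange n \<pi>"
  then obtain P :: "nat \<Rightarrow> real poly" where
    left: "\<forall>\<^sub>F x in at_left 0. \<forall>i\<in>{1..<n}. poly (P i) x < poly (P (i + 1)) x" and
    right: "\<forall>\<^sub>F x in at_right 0. \<forall>i\<in>{1..<n}. poly (P (\<pi> i)) x < poly (P (\<pi> (i + 1))) x"
    unfolding polynomial_interchange_def by blast
  have "realises {1..n} \<pi> (\<lambda>i. P (\<pi> i))"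
    unfolding realises_def
  proof (intro conjI ballI impI)
    fix i j assume ij: "i \<in> {1..n}" "j \<in> {1..n}" "i < j"
    from right show "\<forall>\<^sub>F x in at_right 0. poly (P (\<pi> i)) x < poly (P (\<pi> j)) x"
      by eventually_elim (use ij chain_less[of n "\<lambda>k. poly (P (\<pi> k)) _" i j] in auto)
  next
    fix i j assume ij: "i \<in> {1..n}" "j \<in> {1..n}" "\<pi> i < \<pi> j"
    then have range: "\<pi> i \<in> {1..n}" "\<pi> j \<in> {1..n}"
      using permutes_in_image[OF assms] by auto
    from left show "\<forall>\<^sub>F x in at_left 0. poly (P (\<pi> i)) x < poly (P (\<pi> j)) x"
      by eventually_elim (use ij range chain_less[of n "\<lambda>k. poly (P k) _" "\<pi> i" "\<pi> j"] in auto)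
  qed
  then show "\<exists>Q. realises {1..n} \<pi> Q" by blast
next
  assume "\<exists>Q. realises {1..n} \<pi> Q"
  then obtain Q where Q: "realises {1..n} \<pi> Q" by blast
  define P where "P v = Q (inv \<pi> v)" for v
  have P: "P (\<pi> i) = Q i" for i
    using permutes_inverses(2)[OF assms] by (simp add: P_def)
  show "polynomial_interchange n \<pi>"
    unfolding polynomial_interchange_def
  proof (intro exI[of _ P] conjI eventually_ball_finite ballI)
    fix i assume i: "i \<in> {1..<n}"
    then have "inv \<pi> i \<in> {1..n}" "inv \<pi> (i + 1) \<in> {1..n}"
      using permutes_in_image[OF permutes_inv[OF assms]] by auto
    moreover have "\<pi> (inv \<pi> i) < \<pi> (inv \<pi> (i + 1))"
      using permutes_inverses(1)[OF assms] by simp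
    ultimately show "\<forall>\<^sub>F x in at_left 0. poly (P i) x < poly (P (i + 1)) x"
      using Q unfolding realises_def P_def by blast
  next
    fix i assume "i \<in> {1..<n}"
    then show "\<forall>\<^sub>F x in at_right 0. poly (P (\<pi> i)) x < poly (P (\<pi> (i + 1))) x"
      using Q unfolding realises_def P by auto
  qed auto
qed

section \<open>Realisable maps contain no forbidden pattern\<close>

definition pattern_free :: "'a::linorder set \<Rightarrow> ('a \<Rightarrow> 'b::linorder) \<Rightarrow> bool" where
  "pattern_free S \<pi> \<longleftrightarrow>
     (\<forall>a\<in>S. \<forall>b\<in>S. \<forall>c\<in>S. \<forall>d\<in>S. a < b \<longrightarrow> b < c \<longrightarrow> c < d \<longrightarrow>
        \<not> (\<pi> b < \<pi> d \<and> \<pi> d < \<pi> a \<and> \<pi> a < \<pi> c) \<and>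
        \<not> (\<pi> c < \<pi> a \<and> \<pi> a < \<pi> d \<and> \<pi> d < \<pi> b))"

lemma realises_order_parity:
  assumes "realises S \<pi> Q" "i \<in> S" "j \<in> S" "i < j" "\<pi> i \<noteq> \<pi> j"
  shows "\<forall>\<^sub>F x in at_right 0. poly (Q j - Q i) x > 0"
    and "even (order 0 (Q j - Q i)) \<longleftrightarrow> \<pi> i < \<pi> j"
proof -
  show pos: "\<forall>\<^sub>F x in at_right 0. poly (Q j - Q i) x > 0"
    using assms unfolding realises_def by simp
  show "even (order 0 (Q j - Q i)) \<longleftrightarrow> \<pi> i < \<pi> j"
  proof (rule ccontr)
    assume neq: "\<not> ?thesis"
    have "\<forall>\<^sub>F x::real in at_left 0. False"
    proof (cases "\<pi> i < \<pi> j")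
      case True
      with neq have "\<forall>\<^sub>F x in at_left 0. poly (Q j - Q i) x < 0"
        using sign_at_left_by_order_parity(2)[OF pos] by simp
      moreover from True assms have "\<forall>\<^sub>F x in at_left 0. poly (Q i) x < poly (Q j) x"
        unfolding realises_def by blast
      ultimately show ?thesis by eventually_elim simp
    next
      case False
      with neq have "\<forall>\<^sub>F x in at_left 0. poly (Q j - Q i) x > 0"
        using sign_at_left_by_order_parity(1)[OF pos] by simp
      moreover from False assms have "\<forall>\<^sub>F x in at_left 0. poly (Q j) x < poly (Q i) x"
        unfolding realises_def by force
      ultimately show ?thesis by eventually_elim simp
    qed
    then show False by simp
  qed
qed

lemma realisable_imp_pattern_free:
  assumes Q: "realises S \<pi> Q" and inj: "inj_on \<pi> S"
  shows "pattern_free S \<pi>"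
proof -
  have gap: "(\<forall>\<^sub>F x in at_right 0. poly (Q j - Q i) x > 0) \<and>
      (even (order 0 (Q j - Q i)) \<longleftrightarrow> \<pi> i < \<pi> j)" if "i \<in> S" "j \<in> S" "i < j" for i j
    using realises_order_parity[OF Q that] that inj by (auto dest: inj_onD)
  have key: "(\<pi> a < \<pi> d) = (\<pi> b < \<pi> c)"
    if S: "a \<in> S" "b \<in> S" "c \<in> S" "d \<in> S" and less: "a < b" "b < c" "c < d"
      and "(\<pi> a < \<pi> b) \<noteq> (\<pi> a < \<pi> c)" "(\<pi> c < \<pi> d) \<noteq> (\<pi> b < \<pi> d)" for a b c d
  proof -
    have less': "a < c" "b < d" "a < d" using less by auto
    have "even (order 0 ((Q b - Q a) + (Q c - Q b) + (Q d - Q c))) = even (order 0 (Q c - Q b))"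
      by (rule no_forbidden_parities) (use gap S less less' that(8,9) in auto)
    then show ?thesis
      using gap S less less' by simp
  qed
  show ?thesis
    unfolding pattern_free_def
  proof (intro ballI impI)
    fix a b c d assume "a \<in> S" "b \<in> S" "c \<in> S" "d \<in> S" "a < b" "b < c" "c < d"
    from key[OF this]
    show "\<not> (\<pi> b < \<pi> d \<and> \<pi> d < \<pi> a \<and> \<pi> a < \<pi> c) \<and> \<not> (\<pi> c < \<pi> a \<and> \<pi> a < \<pi> d \<and> \<pi> d < \<pi> b)"
      by (meson less_trans not_less_iff_gr_or_eq)
  qed
qed

section \<open>Pattern-free maps split\<close>

definition sum_split :: "'a::linorder set \<Rightarrow> ('a \<Rightarrow> 'b::linorder) \<Rightarrow> 'a set \<Rightarrow> 'a set \<Rightarrow> bool" where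
  "sum_split S \<pi> A B \<longleftrightarrow> A \<noteq> {} \<and> B \<noteq> {} \<and> S = A \<union> B \<and> (\<forall>a\<in>A. \<forall>b\<in>B. a < b \<and> \<pi> a < \<pi> b)"

text \<open>
  Negation reverses the order of the values and so interchanges the two forbidden patterns.  Hence
  whatever holds for the splits with the left part below the right part holds for the others too.
\<close>

lemma pattern_free_uminus:
  fixes \<pi> :: "'a::linorder \<Rightarrow> int"
  shows "pattern_free S (\<lambda>i. - \<pi> i) \<longleftrightarrow> pattern_free S \<pi>"
  by (simp only: pattern_free_def neg_less_iff_less conj_ac)

lemma pattern_free_subset: "pattern_free S \<pi> \<Longrightarrow> T \<subseteq> S \<Longrightarrow> pattern_free T \<pi>"
  unfolding pattern_free_def by blast

text \<open>
  Take the split with the left part \<open>A\<close> as small as possible.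
  If the new last value \<open>v\<close> is above \<open>A\<close>, the new position joins \<open>B\<close>; if \<open>v\<close> is below \<open>A\<close>, it is
  below everything and is split off.  Otherwise \<open>v\<close> lies strictly inside the range of values on
  \<open>A\<close>.  By minimality \<open>A\<close> has no such split of its own, so it falls into a left part above
  a right part, and one position from each, one from \<open>B\<close> and the last one form a forbidden pattern.
\<close>

lemma extend_sum_split:
  fixes \<pi> :: "'a::linorder \<Rightarrow> int"
  assumes free: "pattern_free S \<pi>" and inj: "inj_on \<pi> S" and fin: "finite S"
    and S: "S = insert m T" "\<And>t. t \<in> T \<Longrightarrow> t < m"
    and split: "sum_split T \<pi> A0 B0"
    and IH: "\<And>A. A \<subset> S \<Longrightarrow> card A \<ge> 2 \<Longrightarrow>
      \<exists>C D. sum_split A \<pi> C D \<or> sum_split A (\<lambda>i. - \<pi> i) C D"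
  shows "\<exists>C D. sum_split S \<pi> C D \<or> sum_split S (\<lambda>i. - \<pi> i) C D"
proof -
  from exists_least_iff[of "\<lambda>k. \<exists>A B. sum_split T \<pi> A B \<and> card A = k"] split
  obtain A B where AB: "sum_split T \<pi> A B"
    and least: "\<And>A' B'. sum_split T \<pi> A' B' \<Longrightarrow> card A \<le> card A'"
    by (metis not_less)
  have nonempty: "A \<noteq> {}" "B \<noteq> {}" and T: "T = A \<union> B"
    and less: "\<And>a b. a \<in> A \<Longrightarrow> b \<in> B \<Longrightarrow> a < b \<and> \<pi> a < \<pi> b"
    using AB unfolding sum_split_def by auto
  have finA: "finite A" using fin S T by auto
  consider (above) "\<forall>a\<in>A. \<pi> a < \<pi> m" | (below) "\<forall>a\<in>A. \<pi> m < \<pi> a"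
    | (inside) a a' where "a \<in> A" "\<pi> m < \<pi> a" "a' \<in> A" "\<pi> a' < \<pi> m"
  proof -
    have "\<pi> a \<noteq> \<pi> m" if "a \<in> A" for a
      using inj that S T by (metis Un_iff inj_onD insertCI less_irrefl)
    then show thesis using that by (meson linorder_less_linear)
  qed
  then show ?thesis
  proof cases
    case above
    then have "sum_split S \<pi> A (insert m B)"
      using nonempty less T S unfolding sum_split_def by auto
    then show ?thesis by blast
  next
    case below
    then have "\<forall>b\<in>B. \<pi> m < \<pi> b" using nonempty(1) less by (meson all_not_in_conv less_trans)
    with below have "sum_split S (\<lambda>i. - \<pi> i) T {m}"
      using nonempty T S unfolding sum_split_def by auto
    then show ?thesis by blast
  next
    case inside
    then have "a \<noteq> a'" by auto
    then have "card A \<ge> 2" using inside finA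
      by (metis card_2_iff card_mono empty_subsetI insert_subset)
    moreover have "A \<subset> S" using T S less nonempty by blast
    ultimately obtain C D where CD: "sum_split A \<pi> C D \<or> sum_split A (\<lambda>i. - \<pi> i) C D"
      using IH by blast
    have "\<not> sum_split A \<pi> C D"
    proof
      assume *: "sum_split A \<pi> C D"
      then have "sum_split T \<pi> C (D \<union> B)"
        using less T nonempty unfolding sum_split_def by auto
      moreover have "C \<subset> A" using * unfolding sum_split_def by blast
      ultimately show False using least finA by (meson not_less psubset_card_mono)
    qed
    with CD have skew: "C \<noteq> {}" "D \<noteq> {}" "A = C \<union> D"
        "\<And>c d. c \<in> C \<Longrightarrow> d \<in> D \<Longrightarrow> c < d \<and> \<pi> d < \<pi> c"
      unfolding sum_split_def by auto
    \<comment> \<open>All values on \<open>D\<close> are below those on \<open>C\<close>.  So if \<open>a\<close> and \<open>a'\<close> both lie in \<open>C\<close>, any element of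
      \<open>D\<close> can replace \<open>a'\<close>, and if both lie in \<open>D\<close>, any element of \<open>C\<close> can replace \<open>a\<close>.\<close>
    obtain c d where cd: "c \<in> C" "d \<in> D" "\<pi> d < \<pi> m" "\<pi> m < \<pi> c"
      using inside skew by (metis Un_iff ex_in_conv less_trans)
    obtain b where b: "b \<in> B" using nonempty by blast
    have "c \<in> S" "d \<in> S" "b \<in> S" "m \<in> S" "c < d" "d < b" "b < m" "\<pi> c < \<pi> b"
      using cd b less skew S T by auto
    with free cd(3,4) show ?thesis unfolding pattern_free_def by blast
  qed
qed

lemma pattern_free_split:
  fixes \<pi> :: "'a::linorder \<Rightarrow> int"
  assumes "finite S" "card S \<ge> 2" "inj_on \<pi> S" "pattern_free S \<pi>"
  shows "\<exists>A B. sum_split S \<pi> A B \<or> sum_split S (\<lambda>i. - \<pi> i) A B"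
  using assms
proof (induction S rule: finite_psubset_induct)
  case (psubset S)
  have IH: "\<exists>C D. sum_split A \<pi> C D \<or> sum_split A (\<lambda>i. - \<pi> i) C D"
    if "A \<subset> S" "card A \<ge> 2" for A
    using psubset that by (meson inj_on_subset pattern_free_subset psubset_imp_subset)
  define m T where "m = Max S" and "T = S - {m}"
  have "S \<noteq> {}" using psubset.prems(1) by auto
  then have m: "m \<in> S" using psubset.hyps m_def by simp
  then have S: "S = insert m T" "\<And>t. t \<in> T \<Longrightarrow> t < m"
    using psubset.hyps by (auto simp: T_def m_def less_le)
  have cardT: "card T = card S - 1" using m psubset.hyps by (simp add: T_def)
  show ?case
  proof (cases "card T \<ge> 2")
    case True
    have "T \<subset> S" using m T_def by auto
    with True IH obtain A B where "sum_split T \<pi> A B \<or> sum_split T (\<lambda>i. - \<pi> i) A B" by blast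
    then show ?thesis
    proof
      assume "sum_split T \<pi> A B"
      from extend_sum_split[OF psubset.prems(3,2) psubset.hyps S this IH] show ?thesis .
    next
      assume *: "sum_split T (\<lambda>i. - \<pi> i) A B"
      have "\<exists>C D. sum_split S (\<lambda>i. - \<pi> i) C D \<or> sum_split S (\<lambda>i. - (- \<pi> i)) C D"
      proof (rule extend_sum_split[OF _ _ psubset.hyps S *])
        show "pattern_free S (\<lambda>i. - \<pi> i)" using psubset.prems by (simp add: pattern_free_uminus)
        show "inj_on (\<lambda>i. - \<pi> i) S" using psubset.prems by (simp add: inj_on_def)
      qed (use IH in \<open>auto\<close>)
      then show ?thesis by auto
    qed
  next
    case False
    then have "card T = 1" using cardT psubset.prems(1) by simp
    then obtain t where t: "T = {t}" by (auto simp: card_1_singleton_iff)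
    then have "t < m" "\<pi> t \<noteq> \<pi> m" using S psubset.prems(2) by (auto simp: inj_on_def)
    then have "sum_split S \<pi> {t} {m} \<or> sum_split S (\<lambda>i. - \<pi> i) {t} {m}"
      using S t unfolding sum_split_def by auto
    then show ?thesis by blast
  qed
qed

section \<open>Realising pattern-free maps\<close>

text \<open>
  As \<open>k < 2\<close>, factoring out \<open>x ^ k\<close> leaves a polynomial with value \<open>1\<close> at \<open>0\<close>, whatever \<open>p\<close> is.
\<close>

lemma glue_pos:
  fixes p :: "real poly"
  assumes "k \<le> 1"
  shows "\<forall>\<^sub>F x in at_right 0. poly (monom 1 k + monom 1 2 * p) x > 0"
    and "\<forall>\<^sub>F x in at_left 0. (-1) ^ k * poly (monom 1 k + monom 1 2 * p) x > 0"
proof -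
  define q where "q = 1 + monom 1 (2 - k) * p"
  have "monom 1 2 = (monom 1 k * monom 1 (2 - k) :: real poly)"
    using assms by (simp add: mult_monom)
  then have val: "poly (monom 1 k + monom 1 2 * p) x = x ^ k * poly q x" for x
    by (simp add: q_def algebra_simps poly_monom flip: power_add)
  have q: "\<forall>\<^sub>F x in at 0 within X. poly q x > 0" for X
    using assms by (intro eventually_poly_pos) (simp add: q_def poly_monom power_0_left)
  show "\<forall>\<^sub>F x in at_right 0. poly (monom 1 k + monom 1 2 * p) x > 0"
    using q at_right_positive by eventually_elim (simp only: val, simp)
  show "\<forall>\<^sub>F x in at_left 0. (-1) ^ k * poly (monom 1 k + monom 1 2 * p) x > 0"
    using q at_left_negative
  proof eventually_elim
    case (elim x)
    from assms have "k = 0 \<or> k = 1" by auto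
    with elim show ?case unfolding val by (auto simp: mult_less_0_iff)
  qed
qed

text \<open>
  Inside each part a difference is multiplied by \<open>x\<^sup>2\<close>, which keeps its sign on both sides of \<open>0\<close>.
  Across the parts the sign is that of \<open>x ^ k\<close>, so \<open>k\<close> decides whether the parts swap.
\<close>

lemma glue_realises:
  fixes \<pi> :: "'a::linorder \<Rightarrow> int"
  assumes QA: "realises A \<pi> QA" and QB: "realises B \<pi> QB"
    and split: "sum_split S \<pi> A B \<and> k = 0 \<or> sum_split S (\<lambda>i. - \<pi> i) A B \<and> k = 1"
  defines "Q \<equiv> \<lambda>i. if i \<in> A then monom 1 2 * QA i else monom 1 k + monom 1 2 * QB i"
  shows "realises S \<pi> Q"
proof -
  have S: "S = A \<union> B" and AB: "\<And>a b. a \<in> A \<Longrightarrow> b \<in> B \<Longrightarrow> a < b"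
    using split unfolding sum_split_def by auto
  have Q_A: "poly (Q i) x = x\<^sup>2 * poly (QA i) x" if "i \<in> A" for i x
    using that by (simp add: Q_def poly_monom)
  have Q_B: "poly (Q i) x = x ^ k + x\<^sup>2 * poly (QB i) x" if "i \<in> B" for i x
    using that AB by (auto simp: Q_def poly_monom)
  have k: "k \<le> 1" using split by auto
  have diff: "poly (Q b) x - poly (Q a) x = poly (monom 1 k + monom 1 2 * (QB b - QA a)) x"
    if "a \<in> A" "b \<in> B" for a b x
    using that by (simp add: Q_A Q_B poly_monom algebra_simps)
  show ?thesis
    unfolding realises_def
  proof (intro conjI ballI impI)
    fix i j assume ij: "i \<in> S" "j \<in> S" "i < j"
    then consider "i \<in> A" "j \<in> A" | "i \<in> B" "j \<in> B" | "i \<in> A" "j \<in> B"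
      using S AB by (auto dest: less_asym)
    then show "\<forall>\<^sub>F x in at_right 0. poly (Q i) x < poly (Q j) x"
    proof cases
      case 1
      with QA ij have "\<forall>\<^sub>F x in at_right 0. poly (QA i) x < poly (QA j) x"
        unfolding realises_def by blast
      with at_right_positive show ?thesis by eventually_elim (simp add: Q_A 1)
    next
      case 2
      with QB ij have "\<forall>\<^sub>F x in at_right 0. poly (QB i) x < poly (QB j) x"
        unfolding realises_def by blast
      with at_right_positive show ?thesis by eventually_elim (simp add: Q_B 2)
    next
      case 3
      from glue_pos(1)[OF k, of "QB j - QA i"] show ?thesis
        unfolding diff[OF 3, symmetric] by eventually_elim simp
    qed
  next
    fix i j assume ij: "i \<in> S" "j \<in> S" "\<pi> i < \<pi> j"
    then consider "i \<in> A" "j \<in> A" | "i \<in> B" "j \<in> B" | "i \<in> A" "j \<in> B" "k = 0" | "j \<in> A" "i \<in> B" "k = 1"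
      using split unfolding sum_split_def by fastforce
    then show "\<forall>\<^sub>F x in at_left 0. poly (Q i) x < poly (Q j) x"
    proof cases
      case 1
      with QA ij have "\<forall>\<^sub>F x in at_left 0. poly (QA i) x < poly (QA j) x"
        unfolding realises_def by blast
      with at_left_negative show ?thesis by eventually_elim (simp add: Q_A 1)
    next
      case 2
      with QB ij have "\<forall>\<^sub>F x in at_left 0. poly (QB i) x < poly (QB j) x"
        unfolding realises_def by blast
      with at_left_negative show ?thesis by eventually_elim (simp add: Q_B 2)
    next
      case 3
      from glue_pos(2)[OF k, of "QB j - QA i"] show ?thesis
        unfolding diff[OF 3(1,2), symmetric] by eventually_elim (simp add: 3)
    next
      case 4
      from glue_pos(2)[OF k, of "QB i - QA j"] show ?thesis
        unfolding diff[OF 4(1,2), symmetric] by eventually_elim (simp add: 4)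
    qed
  qed
qed

lemma pattern_free_imp_realisable:
  fixes \<pi> :: "'a::linorder \<Rightarrow> int"
  assumes "finite S" "inj_on \<pi> S" "pattern_free S \<pi>"
  shows "\<exists>Q. realises S \<pi> Q"
  using assms
proof (induction S rule: finite_psubset_induct)
  case (psubset S)
  show ?case
  proof (cases "card S \<ge> 2")
    case True
    from pattern_free_split[OF psubset.hyps True psubset.prems] obtain A B where
      split: "sum_split S \<pi> A B \<or> sum_split S (\<lambda>i. - \<pi> i) A B" by blast
    then have "A \<subset> S" "B \<subset> S" unfolding sum_split_def by blast+
    with psubset obtain QA QB where "realises A \<pi> QA" "realises B \<pi> QB"
      by (metis inj_on_subset pattern_free_subset psubset_imp_subset)
    with split glue_realises show ?thesis by blast
  next
    case False
    then have "card S \<le> Suc 0" by simp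
    then have "\<forall>i\<in>S. \<forall>j\<in>S. i = j" using card_le_Suc0_iff_eq[OF psubset.hyps] by simp
    then have "realises S \<pi> (\<lambda>_. 0)" unfolding realises_def by (metis less_irrefl)
    then show ?thesis by blast
  qed
qed

section \<open>Polynomial interchanges are the separable permutations\<close>

lemma separable_perm_iff_pattern_free: "separable_perm n \<pi> \<longleftrightarrow> pattern_free {1..n} \<pi>"
proof
  assume sep: "separable_perm n \<pi>"
  show "pattern_free {1..n} \<pi>"
    unfolding pattern_free_def
  proof (intro ballI impI)
    fix a b c d assume "a \<in> {1..n}" "d \<in> {1..n}" "a < b" "b < c" "c < d"
    then have "1 \<le> a \<and> a < b \<and> b < c \<and> c < d \<and> d \<le> n" by simp
    with sep show "\<not> (\<pi> b < \<pi> d \<and> \<pi> d < \<pi> a \<and> \<pi> a < \<pi> c) \<and>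
        \<not> (\<pi> c < \<pi> a \<and> \<pi> a < \<pi> d \<and> \<pi> d < \<pi> b)"
      unfolding separable_perm_def by blast
  qed
next
  assume free: "pattern_free {1..n} \<pi>"
  show "separable_perm n \<pi>"
    unfolding separable_perm_def
  proof (rule notI, elim exE conjE)
    fix a b c d assume "1 \<le> a" "a < b" "b < c" "c < d" "d \<le> n"
      and pattern: "\<pi> b < \<pi> d \<and> \<pi> d < \<pi> a \<and> \<pi> a < \<pi> c \<or>
        \<pi> c < \<pi> a \<and> \<pi> a < \<pi> d \<and> \<pi> d < \<pi> b"
    then have "a \<in> {1..n}" "b \<in> {1..n}" "c \<in> {1..n}" "d \<in> {1..n}" by auto
    with free \<open>a < b\<close> \<open>b < c\<close> \<open>c < d\<close> pattern show False
      unfolding pattern_free_def by blast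
  qed
qed

theorem mainTheorem3:
  fixes n :: nat and \<pi> :: "nat \<Rightarrow> nat"
  assumes "n \<ge> 2" and "\<pi> permutes {1..n}"
  shows "polynomial_interchange n \<pi> \<longleftrightarrow> separable_perm n \<pi>"
proof -
  have inj: "inj_on \<pi> {1..n}" using assms(2) by (rule permutes_inj_on)
  have "(\<exists>Q. realises {1..n} \<pi> Q) \<longleftrightarrow> pattern_free {1..n} \<pi>"
  proof
    assume "pattern_free {1..n} \<pi>"
    then have "pattern_free {1..n} (\<lambda>i. int (\<pi> i))" by (simp only: pattern_free_def of_nat_less_iff)
    moreover have "inj_on (\<lambda>i. int (\<pi> i)) {1..n}" using inj by (simp only: inj_on_def of_nat_eq_iff)
    ultimately have "\<exists>Q. realises {1..n} (\<lambda>i. int (\<pi> i)) Q"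
      by (intro pattern_free_imp_realisable) simp_all
    then show "\<exists>Q. realises {1..n} \<pi> Q" by (simp add: realises_def)
  qed (use inj realisable_imp_pattern_free in blast)
  then show ?thesis
    using polynomial_interchange_iff_realisable[OF assms(2)] separable_perm_iff_pattern_free by simp
qed

end
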